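(* Let $X$ be a topological space and let $\mathcal K$ be a separable family of compact subsets of $X$. Then for any cometrizable space $Y$ the function space $C_{\mathcal K}(X,Y)$ is cometrizable.
   Context: A topological space $Y$ is called cometrizable if it admits a weaker (i.e. contained in the original topology) metrizable topology such that each point $y\in Y$ has a (not necessarily open) neighborhood base, with respect to the original topology of $Y$, consisting of sets that are closed in the metrizable topology. For topological spaces $X,Y$, $C(X,Y)$ denotes the set of all continuous functions from $X$ to $Y$. For a family $\mathcal K$ of compact subsets of $X$, $C_{\mathcal K}(X,Y)$ denotes $C(X,Y)$ endowed with the topology generated by the subbase consisting of the sets $[K,U]:=\{f\in C(X,Y):f(K)\subseteq U\}$, where $K\in\mathcal K$ and $U$ is an open set in $Y$. A family $\mathcal K$ of compact subsets of a topological space $X$ is called separable if: (i) each compact subset of any compact set $K\in\mathcal K$ belongs to $\mathcal K$; (ii) the union $\bigcup\mathcal K$ is dense in $X$; (iii) $\mathcal K$ contains a countable subfamily $\mathcal C$ such that each $K\in\mathcal K$ is contained in a compact set $\tilde K\in\mathcal K$ such that $\tilde K\cap\bigcup\mathcal C$ is dense in $\tilde K$. *)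

theory Defs
  imports "HOL-Analysis.Analysis"
begin

(* In neighbourhood_base_of, the sets of the base are neighbourhoods in the topology Y and
   need not be open; here they are moreover closed in the coarser topology M. *)
definition cometrizable_space :: "'a topology \<Rightarrow> bool" where
  "cometrizable_space Y \<longleftrightarrow>
     (\<exists>M. topspace M = topspace Y \<and> (\<forall>U. openin M U \<longrightarrow> openin Y U) \<and>
          metrizable_space M \<and> neighbourhood_base_of (closedin M) Y)"

(* Maps X \<rightarrow> Y are represented by functions that are undefined outside the carrier of X,
   so that two of them are equal iff they agree on topspace X. *)
definition continuous_maps :: "'a topology \<Rightarrow> 'b topology \<Rightarrow> ('a \<Rightarrow> 'b) set" where
  "continuous_maps X Y = {f \<in> extensional (topspace X). continuous_map X Y f}"

(* The whole set is a member of the subbase, as the empty intersection; this only matters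
   when \<K> is empty, since [K, topspace Y] is the whole set for any K in \<K>. *)
definition compact_family_topology ::
    "'a topology \<Rightarrow> 'a set set \<Rightarrow> 'b topology \<Rightarrow> ('a \<Rightarrow> 'b) topology" where
  "compact_family_topology X \<K> Y =
     topology_generated_by
       (insert (continuous_maps X Y)
          {{f \<in> continuous_maps X Y. f ` K \<subseteq> U} | K U. K \<in> \<K> \<and> openin Y U})"

lemma topspace_compact_family_topology [simp]:
  "topspace (compact_family_topology X \<K> Y) = continuous_maps X Y"
  by (auto simp: compact_family_topology_def)

definition separable_compact_family :: "'a topology \<Rightarrow> 'a set set \<Rightarrow> bool" where
  "separable_compact_family X \<K> \<longleftrightarrow>
     (\<forall>K\<in>\<K>. compactin X K) \<and>
     (\<forall>K\<in>\<K>. \<forall>L. compactin X L \<and> L \<subseteq> K \<longrightarrow> L \<in> \<K>) \<and>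
     X closure_of (\<Union>\<K>) = topspace X \<and>
     (\<exists>\<C>. \<C> \<subseteq> \<K> \<and> countable \<C> \<and>
        (\<forall>K\<in>\<K>. \<exists>K'\<in>\<K>. K \<subseteq> K' \<and> subtopology X K' closure_of (K' \<inter> \<Union>\<C>) = K'))"

end

theory Submission
  imports Defs
begin

text \<open>
  Let \<open>M\<close> be a metrizable topology, coarser than that of \<open>Y\<close>, for which every point of \<open>Y\<close> has
  arbitrarily small \<open>M\<close>-closed neighbourhoods; let \<open>m\<close> be a metric for \<open>M\<close>, and let \<open>\<C>\<close> be the
  countable subfamily of \<open>\<K>\<close> given by separability. The coarser topology on the function space is
  that of \<open>m\<close>-uniform convergence on each member of \<open>\<C>\<close>
  (\<open>uniform_topology_on_subfamily\<close>).

  It is metrizable because it is induced by an injection into a countable product of sup-metric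
  spaces. Injectivity is the density condition: two continuous maps that agree on \<open>\<Union>\<C>\<close> agree on
  all members of \<open>\<K>\<close>, hence on \<open>X\<close>, since \<open>M\<close> is Hausdorff. It is coarser than the topology
  of the function space because, on a compact set, uniform closeness to \<open>f\<close> follows from finitely many
  conditions of the form \<open>[L, V]\<close>; the sets \<open>L\<close> are compact subsets of a member of \<open>\<C>\<close>, so they
  belong to \<open>\<K>\<close> (\<open>continuous_map_restrict_cfunspace\<close>).

  The closed neighbourhoods are the crux (\<open>subbasic_neighbourhood_closed_in_uniform_topology\<close>).
  Given \<open>f\<close> in \<open>[K0, U]\<close>, enlarge \<open>K0\<close> to a member \<open>K\<close> of \<open>\<K>\<close> in which
  \<open>D = K \<inter> \<Union>\<C>\<close> is dense. Around each point \<open>f x\<close> with \<open>x \<in> K0\<close> there is a chain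
  \<open>Q \<subseteq> W \<subseteq> P \<subseteq> V \<subseteq> U\<close> with \<open>Q\<close>, \<open>P\<close> open, \<open>W\<close> closed and \<open>V\<close> closed in \<open>M\<close>; finitely many
  of the sets \<open>Q\<close> suffice to cover \<open>f ` K0\<close>. Consider the requirement that \<open>g y \<in> V\<close> whenever
  \<open>y \<in> D\<close> and \<open>f y \<in> Q\<close>. It only concerns values of \<open>g\<close> at points of \<open>\<Union>\<C>\<close>, hence it is closed
  in the coarser topology. By density it extends to all \<open>y \<in> K\<close> with \<open>f y \<in> Q\<close>, so it forces
  \<open>g ` K0 \<subseteq> U\<close>. Finally it is implied by \<open>g \<in> [K \<inter> f -` W, P]\<close>, an open condition that \<open>f\<close>
  satisfies, as \<open>K \<inter> f -` W\<close> is a compact subset of \<open>K\<close>. The density argument uses the open set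
  \<open>Q\<close> and the compactness argument the closed set \<open>W\<close>, which is why a chain of sets is needed.
\<close>

section \<open>Separable families\<close>

lemma mem_continuous_mapsD:
  assumes "f \<in> continuous_maps X Y"
  shows "continuous_map X Y f" "f \<in> extensional (topspace X)"
  using assms by (auto simp: continuous_maps_def)

lemma continuous_map_coarser_codomain:
  assumes "continuous_map X Y f" "topspace M = topspace Y" "\<And>U. openin M U \<Longrightarrow> openin Y U"
  shows "continuous_map X M f"
  using assms by (simp add: continuous_map_def)

text \<open>The points \<open>z\<close> with \<open>f z \<in> U\<close> and \<open>g z \<notin> V\<close> form an open set; if it met \<open>K\<close>, it would
  meet the dense part \<open>K \<inter> D\<close>.\<close>

lemma closed_condition_on_dense_part:
  assumes "subtopology X K closure_of (K \<inter> D) = K" "K \<subseteq> topspace X"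
    and "continuous_map X Y f" "continuous_map X Y g"
    and "openin Y U" "closedin Y V"
    and dense: "\<And>y. y \<in> K \<inter> D \<Longrightarrow> f y \<in> U \<Longrightarrow> g y \<in> V"
    and "x \<in> K" "f x \<in> U"
  shows "g x \<in> V"
proof (rule ccontr)
  assume "g x \<notin> V"
  let ?O = "{z \<in> topspace X. f z \<in> U} \<inter> {z \<in> topspace X. g z \<in> topspace Y - V}"
  have "openin X ?O"
    using assms by (intro openin_Int openin_continuous_map_preimage) auto
  moreover have "x \<in> ?O"
    using assms \<open>g x \<notin> V\<close> continuous_map_funspace[of X Y g] by auto
  moreover have "x \<in> X closure_of (K \<inter> D)"
    using subsetD[OF closure_of_subtopology_subset, of x X K "K \<inter> D"] assms(1) \<open>x \<in> K\<close> by simp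
  ultimately have "\<exists>y. y \<in> K \<inter> D \<and> y \<in> ?O"
    unfolding in_closure_of by meson
  then obtain y where "y \<in> K \<inter> D" "y \<in> ?O"
    by blast
  then show False
    using dense by auto
qed

text \<open>Uniqueness of continuous extensions is used twice: from \<open>K' \<inter> D\<close> to \<open>K'\<close>, and then from
  \<open>\<Union>\<K>\<close> to \<open>X\<close>.\<close>

lemma continuous_maps_eq_if_eq_on_dense_subfamily:
  assumes "X closure_of (\<Union>\<K>) = topspace X" "\<forall>K\<in>\<K>. K \<subseteq> topspace X"
    and dense: "\<forall>K\<in>\<K>. \<exists>K'\<in>\<K>. K \<subseteq> K' \<and> subtopology X K' closure_of (K' \<inter> D) = K'"
    and "Hausdorff_space M"
    and fg: "continuous_map X M f" "continuous_map X M g"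
    and eq: "\<And>x. x \<in> D \<Longrightarrow> f x = g x"
    and "x \<in> topspace X"
  shows "f x = g x"
proof -
  have "f y = g y" if "K \<in> \<K>" "y \<in> K" for K y
  proof -
    obtain K' where K': "K' \<in> \<K>" "K \<subseteq> K'" "subtopology X K' closure_of (K' \<inter> D) = K'"
      using dense \<open>K \<in> \<K>\<close> by blast
    then have "y \<in> subtopology X K' closure_of (K' \<inter> D)"
      using \<open>y \<in> K\<close> by auto
    then show ?thesis
      by (rule forall_in_closure_of_eq[OF _ \<open>Hausdorff_space M\<close>])
         (use fg eq in \<open>auto intro: continuous_map_from_subtopology\<close>)
  qed
  then show ?thesis
    using forall_in_closure_of_eq[of x X "\<Union>\<K>" M f g] assms by auto
qed

section \<open>Neighbourhoods in the function space\<close>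

lemma openin_compact_family_topology_subbasic:
  assumes "K \<in> \<K>" "openin Y U"
  shows "openin (compact_family_topology X \<K> Y) {f \<in> continuous_maps X Y. f ` K \<subseteq> U}"
  unfolding compact_family_topology_def using assms by (intro topology_generated_by_Basis) blast

text \<open>Each condition is a subbasic set \<open>[L, V i]\<close>, where \<open>L\<close> is the set of points of \<open>K\<close> that
  \<open>f\<close> sends into \<open>W i\<close>: it is compact because \<open>W i\<close> is closed, and thus belongs to \<open>\<K>\<close>.\<close>

lemma openin_compact_family_finite_conditions:
  assumes K: "K \<in> \<K>" "compactin X K" "\<And>L. compactin X L \<Longrightarrow> L \<subseteq> K \<Longrightarrow> L \<in> \<K>"
    and f: "continuous_map X Y f" and "finite F"
    and W: "\<And>i. i \<in> F \<Longrightarrow> closedin Y (W i)" and V: "\<And>i. i \<in> F \<Longrightarrow> openin Y (V i)"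
  shows "openin (compact_family_topology X \<K> Y)
           {g \<in> continuous_maps X Y. \<forall>i\<in>F. \<forall>y\<in>K. f y \<in> W i \<longrightarrow> g y \<in> V i}"
  using \<open>finite F\<close> W V
proof (induction F)
  case empty
  then show ?case
    using openin_topspace[of "compact_family_topology X \<K> Y"] by simp
next
  case (insert i F)
  define L where "L = {y \<in> topspace X. f y \<in> W i} \<inter> K"
  have "closedin X {y \<in> topspace X. f y \<in> W i}"
    using closedin_continuous_map_preimage[OF f] insert.prems by simp
  then have "compactin X L"
    unfolding L_def using K by (intro closed_Int_compactin) auto
  then have "L \<in> \<K>"
    using K by (simp add: L_def)
  then have "openin (compact_family_topology X \<K> Y) {g \<in> continuous_maps X Y. g ` L \<subseteq> V i}"
    using insert.prems by (intro openin_compact_family_topology_subbasic) auto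
  moreover have "openin (compact_family_topology X \<K> Y)
      {g \<in> continuous_maps X Y. \<forall>i\<in>F. \<forall>y\<in>K. f y \<in> W i \<longrightarrow> g y \<in> V i}"
    using insert by simp
  ultimately have "openin (compact_family_topology X \<K> Y)
      ({g \<in> continuous_maps X Y. g ` L \<subseteq> V i} \<inter>
       {g \<in> continuous_maps X Y. \<forall>i\<in>F. \<forall>y\<in>K. f y \<in> W i \<longrightarrow> g y \<in> V i})"
    by (rule openin_Int)
  also have "\<dots> = {g \<in> continuous_maps X Y. \<forall>i\<in>insert i F. \<forall>y\<in>K. f y \<in> W i \<longrightarrow> g y \<in> V i}"
    using compactin_subset_topspace[OF K(2)] by (auto simp: L_def)
  finally show ?case .
qed

text \<open>Reduces the search for closed neighbourhoods to subbasic open sets.\<close>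

lemma neighbourhood_base_of_topology_generated_by:
  assumes Int: "\<And>V W. P V \<Longrightarrow> P W \<Longrightarrow> P (V \<inter> W)"
    and basic: "\<And>S x. S \<in> \<S> \<Longrightarrow> x \<in> S \<Longrightarrow>
        \<exists>U V. openin (topology_generated_by \<S>) U \<and> P V \<and> x \<in> U \<and> U \<subseteq> V \<and> V \<subseteq> S"
  shows "neighbourhood_base_of P (topology_generated_by \<S>)"
  unfolding neighbourhood_base_of
proof (intro allI impI, elim conjE)
  fix W x
  assume "openin (topology_generated_by \<S>) W" "x \<in> W"
  then have "generate_topology_on \<S> W"
    by (simp add: openin_topology_generated_by_iff)
  then show "\<exists>U V. openin (topology_generated_by \<S>) U \<and> P V \<and> x \<in> U \<and> U \<subseteq> V \<and> V \<subseteq> W"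
    using \<open>x \<in> W\<close>
  proof (induction arbitrary: x)
    case Empty
    then show ?case by simp
  next
    case (Int A B)
    then obtain U V U' V'
      where "openin (topology_generated_by \<S>) U" "P V" "x \<in> U" "U \<subseteq> V" "V \<subseteq> A"
        and "openin (topology_generated_by \<S>) U'" "P V'" "x \<in> U'" "U' \<subseteq> V'" "V' \<subseteq> B"
      by (metis IntE)
    then show ?case
      by (intro exI[of _ "U \<inter> U'"] exI[of _ "V \<inter> V'"]) (auto intro: assms(1))
  next
    case (UN \<A>)
    then obtain A where "A \<in> \<A>" "x \<in> A" by blast
    with UN.IH obtain U V
      where "openin (topology_generated_by \<S>) U" "P V" "x \<in> U" "U \<subseteq> V" "V \<subseteq> A" by metis
    with \<open>A \<in> \<A>\<close> show ?case by (meson Union_upper subset_trans)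
  next
    case (Basis S)
    then show ?case by (rule basic)
  qed
qed

section \<open>Uniform convergence on members of the family\<close>

lemma restrict_in_mspace_cfunspace:
  assumes "compactin X K" "continuous_map X (mtopology_of m) f"
  shows "restrict f K \<in> mspace (cfunspace (subtopology X K) m)"
proof -
  have K: "topspace (subtopology X K) = K"
    using compactin_subset_topspace[OF assms(1)] by auto
  moreover have "compactin (subtopology X K) K"
    using assms(1) by (simp add: compactin_subtopology)
  moreover have "continuous_map (subtopology X K) (mtopology_of m) (restrict f K)"
    by (rule continuous_map_eq[OF continuous_map_from_subtopology[OF assms(2)]])
       (use K in auto)
  moreover have "\<forall>x\<in>K. f x \<in> mspace m"
    using assms compactin_subset_topspace[OF assms(1)] continuous_map_funspace[OF assms(2)] by auto
  ultimately show ?thesis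
    by (subst compactin_mspace_cfunspace) auto
qed

text \<open>The compact-open topology is finer than the topology of uniform convergence on compact sets:
  \<open>K\<close> is covered by the preimages of finitely many balls of radius \<open>\<epsilon>/4\<close> around points \<open>f x\<close>, and
  it suffices that \<open>g\<close> sends the part of \<open>K\<close> lying over each closed ball into the slightly larger
  open ball of radius \<open>\<epsilon>/3\<close>. Then \<open>f\<close> and \<open>g\<close> differ on \<open>K\<close> by at most
  \<open>\<epsilon>/4 + \<epsilon>/3 = 7\<epsilon>/12\<close>. Closed balls are what makes those parts of \<open>K\<close> compact.\<close>

lemma continuous_map_restrict_cfunspace:
  assumes K: "K \<in> \<K>" "compactin X K" "\<And>L. compactin X L \<Longrightarrow> L \<subseteq> K \<Longrightarrow> L \<in> \<K>"
    and top: "mspace m = topspace Y" and coarser: "\<And>U. openin (mtopology_of m) U \<Longrightarrow> openin Y U"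
  shows "continuous_map (compact_family_topology X \<K> Y)
           (mtopology_of (cfunspace (subtopology X K) m)) (\<lambda>f. restrict f K)"
proof -
  let ?S = "cfunspace (subtopology X K) m"
  interpret m: Metric_space "mspace m" "mdist m" by simp
  interpret S: Metric_space "mspace ?S" "mdist ?S" by (rule Metric_space_mspace_mdist)
  have KX: "topspace (subtopology X K) = K"
    using compactin_subset_topspace[OF K(2)] by auto
  have opn: "openin Y (m.mball c r)" for c r
    using coarser by (simp add: mtopology_of_def)
  have cls: "closedin Y (m.mcball c r)" for c r
    using m.closedin_mcball[of c r] coarser top
    by (metis closedin_def mtopology_of_def topspace_mtopology_of)
  have cont: "continuous_map X (mtopology_of m) f" if "f \<in> continuous_maps X Y" for f
    by (rule continuous_map_coarser_codomain[OF mem_continuous_mapsD(1)[OF that]])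
       (use top coarser in auto)
  have "\<exists>U. openin (compact_family_topology X \<K> Y) U \<and> f \<in> U \<and>
            (\<forall>g\<in>U. restrict g K \<in> S.mball (restrict f K) \<epsilon>)"
    if f: "f \<in> continuous_maps X Y" and "\<epsilon> > 0" for f and \<epsilon> :: real
  proof -
    define B where "B x = {y \<in> topspace X. f y \<in> m.mball (f x) (\<epsilon>/4)}" for x
    have fm: "f x \<in> mspace m" if "x \<in> K" for x
      using that KX compactin_subset_topspace[OF K(2)] continuous_map_funspace[OF cont[OF f]] by auto
    have "openin X (B x)" for x
      unfolding B_def using openin_continuous_map_preimage[OF mem_continuous_mapsD(1)[OF f] opn] .
    moreover have "K \<subseteq> \<Union>(B ` K)"
      using fm \<open>\<epsilon> > 0\<close> compactin_subset_topspace[OF K(2)] by (auto simp: B_def)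
    ultimately obtain \<B> where "finite \<B>" "\<B> \<subseteq> B ` K" "K \<subseteq> \<Union>\<B>"
      using compactinD[OF K(2), of "B ` K"] by blast
    then obtain F where F: "finite F" "F \<subseteq> K" "K \<subseteq> \<Union>(B ` F)"
      by (metis finite_subset_image)
    define U where "U = {g \<in> continuous_maps X Y.
      \<forall>x\<in>F. \<forall>y\<in>K. f y \<in> m.mcball (f x) (\<epsilon>/4) \<longrightarrow> g y \<in> m.mball (f x) (\<epsilon>/3)}"
    have "openin (compact_family_topology X \<K> Y) U"
      unfolding U_def
      using openin_compact_family_finite_conditions[OF K mem_continuous_mapsD(1)[OF f] F(1) cls opn] .
    moreover have "f \<in> U"
      using f \<open>\<epsilon> > 0\<close> by (auto simp: U_def)
    moreover have "restrict g K \<in> S.mball (restrict f K) \<epsilon>" if "g \<in> U" for g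
    proof -
      have g: "g \<in> continuous_maps X Y" using that by (simp add: U_def)
      have "mdist m (f y) (g y) \<le> 7/12 * \<epsilon>" if "y \<in> K" for y
      proof -
        obtain x where x: "x \<in> F" "y \<in> B x" using F \<open>y \<in> K\<close> by blast
        then have 1: "f y \<in> m.mball (f x) (\<epsilon>/4)" by (simp add: B_def)
        then have "f y \<in> m.mcball (f x) (\<epsilon>/4)" using m.mball_subset_mcball by blast
        then have "g y \<in> m.mball (f x) (\<epsilon>/3)"
          using \<open>g \<in> U\<close> x(1) \<open>y \<in> K\<close> by (auto simp: U_def)
        with 1 show ?thesis
          using m.triangle[of "f y" "f x" "g y"] m.commute[of "f x" "f y"] by auto
      qed
      then have "mdist ?S (restrict f K) (restrict g K) \<le> 7/12 * \<epsilon>"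
        using \<open>\<epsilon> > 0\<close> KX by (intro mdist_cfunspace_le) auto
      then show ?thesis
        using restrict_in_mspace_cfunspace[OF K(2) cont[OF f]]
          restrict_in_mspace_cfunspace[OF K(2) cont[OF g]] \<open>\<epsilon> > 0\<close>
        by (simp only: S.in_mball) auto
    qed
    ultimately show ?thesis by blast
  qed
  then show ?thesis
    unfolding mtopology_of_def S.continuous_map_to_metric by simp
qed

lemma continuous_map_eval_cfunspace:
  assumes "x \<in> topspace X"
  shows "continuous_map (mtopology_of (cfunspace X m)) (mtopology_of m) (\<lambda>f. f x)"
proof -
  let ?S = "cfunspace X m"
  interpret m: Metric_space "mspace m" "mdist m" by simp
  interpret S: Metric_space "mspace ?S" "mdist ?S" by (rule Metric_space_mspace_mdist)
  have "\<exists>U. openin S.mtopology U \<and> f \<in> U \<and> (\<forall>g\<in>U. g x \<in> m.mball (f x) \<epsilon>)"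
    if f: "f \<in> mspace ?S" and "\<epsilon> > 0" for f and \<epsilon> :: real
  proof (intro exI conjI ballI)
    show "openin S.mtopology (S.mball f (\<epsilon>/2))" by (rule S.openin_mball)
    show "f \<in> S.mball f (\<epsilon>/2)" using that by (simp only: S.centre_in_mball_iff) auto
    fix g assume "g \<in> S.mball f (\<epsilon>/2)"
    then have g: "g \<in> mspace ?S" "mdist ?S f g \<le> \<epsilon>/2"
      by (simp_all only: S.in_mball order_less_imp_le)
    then have "mdist m (f x) (g x) \<le> \<epsilon>/2"
      using mdist_cfunspace_imp_mdist_le[OF f] assms by blast
    then show "g x \<in> m.mball (f x) \<epsilon>"
      using f g assms \<open>\<epsilon> > 0\<close> by auto
  qed
  then show ?thesis
    unfolding mtopology_of_def m.continuous_map_to_metric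
    by (simp only: S.topspace_mtopology) blast
qed

lemma metrizable_space_pullback_topology:
  assumes "metrizable_space T" "inj_on e A"
  shows "metrizable_space (pullback_topology A e T)"
proof -
  let ?N = "pullback_topology A e T" and ?R = "subtopology T (e ` A)"
  have sub: "topspace ?N \<subseteq> A" by (auto simp: topspace_pullback_topology)
  have "continuous_map ?N T e"
    using continuous_map_pullback[OF continuous_map_id, of A e T] by simp
  then have "continuous_map ?N ?R e"
    using sub by (auto simp: continuous_map_in_subtopology)
  moreover have "open_map ?N ?R e"
    by (auto simp: open_map_def openin_pullback_topology openin_subtopology)
  moreover have "inj_on e (topspace ?N)"
    using assms(2) sub inj_on_subset by blast
  ultimately have "embedding_map ?N ?R e"
    by (rule injective_open_imp_embedding_map)
  then have "?N homeomorphic_space subtopology ?R (e ` topspace ?N)"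
    by (rule embedding_map_imp_homeomorphic_space)
  then show ?thesis
    using assms(1) homeomorphic_metrizable_space metrizable_space_subtopology by blast
qed

section \<open>The coarser metrizable topology\<close>

text \<open>The topology of \<open>m\<close>-uniform convergence on every member of \<open>\<C>\<close>. Writing it as a pullback of
  a product gives metrizability for countable \<open>\<C>\<close> without an explicit metric on the maps.\<close>

definition uniform_topology_on_subfamily ::
    "'a topology \<Rightarrow> 'a set set \<Rightarrow> 'b topology \<Rightarrow> 'b metric \<Rightarrow> ('a \<Rightarrow> 'b) topology" where
  "uniform_topology_on_subfamily X \<C> Y m =
     pullback_topology (continuous_maps X Y) (\<lambda>f. \<lambda>K\<in>\<C>. restrict f K)
       (product_topology (\<lambda>K. mtopology_of (cfunspace (subtopology X K) m)) \<C>)"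

context
  fixes X :: "'a topology" and Y :: "'b topology" and \<C> :: "'a set set" and m :: "'b metric"
  assumes compact: "\<And>K. K \<in> \<C> \<Longrightarrow> compactin X K"
    and top: "mspace m = topspace Y" and coarser: "\<And>U. openin (mtopology_of m) U \<Longrightarrow> openin Y U"
begin

lemma continuous_maps_into_metric:
  "f \<in> continuous_maps X Y \<Longrightarrow> continuous_map X (mtopology_of m) f"
  by (rule continuous_map_coarser_codomain[OF mem_continuous_mapsD(1)[of f X Y]]) (simp_all add: top coarser)

lemma topspace_uniform_topology_on_subfamily:
  "topspace (uniform_topology_on_subfamily X \<C> Y m) = continuous_maps X Y"
proof -
  have "(\<lambda>K\<in>\<C>. restrict f K) \<in> (\<Pi>\<^sub>E K\<in>\<C>. mspace (cfunspace (subtopology X K) m))"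
    if "f \<in> continuous_maps X Y" for f
    by (rule restrict_PiE_iff[THEN iffD2])
       (use restrict_in_mspace_cfunspace[OF compact continuous_maps_into_metric[OF that]] in blast)
  then show ?thesis
    by (simp only: uniform_topology_on_subfamily_def topspace_pullback_topology
        topspace_product_topology comp_def topspace_mtopology_of) blast
qed

lemma uniform_topology_on_subfamily_coarser:
  assumes "\<C> \<subseteq> \<K>" "\<And>K L. K \<in> \<K> \<Longrightarrow> compactin X L \<Longrightarrow> L \<subseteq> K \<Longrightarrow> L \<in> \<K>"
    and "openin (uniform_topology_on_subfamily X \<C> Y m) U"
  shows "openin (compact_family_topology X \<K> Y) U"
proof -
  let ?T = "compact_family_topology X \<K> Y" and ?e = "\<lambda>f::'a \<Rightarrow> 'b. \<lambda>K\<in>\<C>. restrict f K"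
  let ?P = "product_topology (\<lambda>K. mtopology_of (cfunspace (subtopology X K) m)) \<C>"
  have "continuous_map ?T (mtopology_of (cfunspace (subtopology X K) m)) (\<lambda>f. ?e f K)"
    if "K \<in> \<C>" for K
  proof -
    have "continuous_map ?T (mtopology_of (cfunspace (subtopology X K) m)) (\<lambda>f. restrict f K)"
      using that assms compact top coarser by (intro continuous_map_restrict_cfunspace) auto
    then show ?thesis using that by simp
  qed
  then have e: "continuous_map ?T ?P ?e"
    by (auto simp: continuous_map_componentwise)
  obtain V where V: "openin ?P V" "U = ?e -` V \<inter> continuous_maps X Y"
    using assms(3) by (auto simp: uniform_topology_on_subfamily_def openin_pullback_topology)
  have "openin ?T {f \<in> topspace ?T. ?e f \<in> V}"
    using openin_continuous_map_preimage[OF e V(1)] .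
  moreover have "{f \<in> topspace ?T. ?e f \<in> V} = U"
    using V(2) by auto
  ultimately show ?thesis by simp
qed

lemma metrizable_uniform_topology_on_subfamily:
  assumes "countable \<C>"
    and inj: "\<And>f g. f \<in> continuous_maps X Y \<Longrightarrow> g \<in> continuous_maps X Y \<Longrightarrow>
      (\<And>x. x \<in> \<Union>\<C> \<Longrightarrow> f x = g x) \<Longrightarrow> f = g"
  shows "metrizable_space (uniform_topology_on_subfamily X \<C> Y m)"
  unfolding uniform_topology_on_subfamily_def
proof (rule metrizable_space_pullback_topology)
  have "metrizable_space (mtopology_of (cfunspace (subtopology X K) m))" for K
    unfolding mtopology_of_def
    by (rule Metric_space.metrizable_space_mtopology[OF Metric_space_mspace_mdist])
  then show "metrizable_space
      (product_topology (\<lambda>K. mtopology_of (cfunspace (subtopology X K) m)) \<C>)"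
    using assms(1) unfolding metrizable_space_product_topology
    by (intro disjI2 conjI countable_subset[OF _ \<open>countable \<C>\<close>]) auto
  show "inj_on (\<lambda>f. \<lambda>K\<in>\<C>. restrict f K) (continuous_maps X Y)"
  proof (rule inj_onI)
    fix f g :: "'a \<Rightarrow> 'b"
    assume fg: "f \<in> continuous_maps X Y" "g \<in> continuous_maps X Y"
      and eq: "(\<lambda>K\<in>\<C>. restrict f K) = (\<lambda>K\<in>\<C>. restrict g K)"
    have "f x = g x" if "K \<in> \<C>" "x \<in> K" for K x
    proof -
      have "restrict f K = restrict g K"
        using fun_cong[OF eq, of K] that by simp
      then show ?thesis using that by (metis restrict_apply')
    qed
    then show "f = g" by (intro inj[OF fg]) blast
  qed
qed

text \<open>Evaluation at a point of \<open>\<Union>\<C>\<close> is continuous into \<open>m\<close>, so conditions with \<open>m\<close>-closed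
  targets at any number of such points define a closed set.\<close>

lemma closedin_uniform_topology_on_subfamily:
  assumes "D \<subseteq> \<Union>\<C>" "\<And>x. x \<in> D \<Longrightarrow> closedin (mtopology_of m) (V x)"
  shows "closedin (uniform_topology_on_subfamily X \<C> Y m)
           {g \<in> continuous_maps X Y. \<forall>x\<in>D. g x \<in> V x}"
proof -
  let ?N = "uniform_topology_on_subfamily X \<C> Y m" and ?e = "\<lambda>f::'a \<Rightarrow> 'b. \<lambda>K\<in>\<C>. restrict f K"
  let ?P = "product_topology (\<lambda>K. mtopology_of (cfunspace (subtopology X K) m)) \<C>"
  have eval: "continuous_map ?N (mtopology_of m) (\<lambda>g. g x)" if "K \<in> \<C>" "x \<in> K" for K x
  proof -
    have "continuous_map ?N ?P (id \<circ> ?e)"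
      unfolding uniform_topology_on_subfamily_def
      by (rule continuous_map_pullback[OF continuous_map_id])
    then have e: "continuous_map ?N (mtopology_of (cfunspace (subtopology X K) m)) ((\<lambda>h. h K) \<circ> (id \<circ> ?e))"
      by (rule continuous_map_compose[OF _ continuous_map_product_projection[OF \<open>K \<in> \<C>\<close>]])
    have "x \<in> topspace (subtopology X K)"
      using that compact compactin_subset_topspace by fastforce
    from continuous_map_compose[OF e continuous_map_eval_cfunspace[OF this]]
    show ?thesis
      using that by (simp add: comp_def)
  qed
  have "closedin ?N {g \<in> topspace ?N. g x \<in> V x}" if x: "x \<in> D" for x
  proof -
    obtain K where "K \<in> \<C>" "x \<in> K" using x assms(1) by blast
    from closedin_continuous_map_preimage[OF eval[OF this] assms(2)[OF x]] show ?thesis .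
  qed
  then have "closedin ?N (\<Inter>(insert (topspace ?N) ((\<lambda>x. {g \<in> topspace ?N. g x \<in> V x}) ` D)))"
    by (intro closedin_Inter) auto
  also have "\<Inter>(insert (topspace ?N) ((\<lambda>x. {g \<in> topspace ?N. g x \<in> V x}) ` D)) =
      {g \<in> continuous_maps X Y. \<forall>x\<in>D. g x \<in> V x}"
    using topspace_uniform_topology_on_subfamily by auto
  finally show ?thesis .
qed

text \<open>Here \<open>G\<close> tests the points of \<open>K\<close> over the closed sets \<open>W x\<close>, which keeps it open, and \<open>H\<close>
  tests only the points of \<open>K \<inter> \<Union>\<C>\<close> over the smaller open sets \<open>Q x\<close>, which makes it closed
  and, by density, still strong enough to control \<open>g\<close> on \<open>K0\<close>.\<close>

lemma subbasic_neighbourhood_closed_in_uniform_topology: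
  assumes base: "neighbourhood_base_of (closedin (mtopology_of m)) Y"
    and K: "K \<in> \<K>" "compactin X K" "\<And>L. compactin X L \<Longrightarrow> L \<subseteq> K \<Longrightarrow> L \<in> \<K>"
    and dense: "subtopology X K closure_of (K \<inter> \<Union>\<C>) = K"
    and K0: "compactin X K0" "K0 \<subseteq> K"
    and f: "f \<in> continuous_maps X Y" and U: "openin Y U" "f ` K0 \<subseteq> U"
  shows "\<exists>G H. openin (compact_family_topology X \<K> Y) G \<and>
           closedin (uniform_topology_on_subfamily X \<C> Y m) H \<and>
           f \<in> G \<and> G \<subseteq> H \<and> H \<subseteq> {g \<in> continuous_maps X Y. g ` K0 \<subseteq> U}"
proof -
  have closed: "closedin Y V" if "closedin (mtopology_of m) V" for V
    using that top coarser by (auto simp: closedin_def)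
  have nbhd: "\<exists>P V. openin Y P \<and> closedin (mtopology_of m) V \<and> z \<in> P \<and> P \<subseteq> V \<and> V \<subseteq> S"
    if "openin Y S" "z \<in> S" for S z
    by (rule base[unfolded neighbourhood_base_of, rule_format, OF conjI, OF that])
  have "\<exists>Q W P V. openin Y Q \<and> closedin Y W \<and> openin Y P \<and> closedin (mtopology_of m) V \<and>
          f x \<in> Q \<and> Q \<subseteq> W \<and> W \<subseteq> P \<and> P \<subseteq> V \<and> V \<subseteq> U" if "x \<in> K0" for x
  proof -
    have "f x \<in> U" using U(2) that by blast
    from nbhd[OF U(1) this] obtain P V
      where P: "openin Y P" "closedin (mtopology_of m) V" "f x \<in> P" "P \<subseteq> V" "V \<subseteq> U"
      by (elim exE conjE)
    from nbhd[OF P(1,3)] obtain Q W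
      where Q: "openin Y Q" "closedin (mtopology_of m) W" "f x \<in> Q" "Q \<subseteq> W" "W \<subseteq> P"
      by (elim exE conjE)
    show ?thesis
      by (rule exI[of _ Q], rule exI[of _ W], rule exI[of _ P], rule exI[of _ V])
         (intro conjI P Q closed[OF Q(2)])
  qed
  then obtain Q W P V where
    chain: "\<And>x. x \<in> K0 \<Longrightarrow> openin Y (Q x) \<and> closedin Y (W x) \<and> openin Y (P x) \<and>
        closedin (mtopology_of m) (V x) \<and>
        f x \<in> Q x \<and> Q x \<subseteq> W x \<and> W x \<subseteq> P x \<and> P x \<subseteq> V x \<and> V x \<subseteq> U"
    by metis
  note fc = mem_continuous_mapsD(1)[OF f]
  define B where "B x = {y \<in> topspace X. f y \<in> Q x}" for x
  have "openin X (B x)" if "x \<in> K0" for x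
    unfolding B_def using openin_continuous_map_preimage[OF fc] chain[OF that] by blast
  moreover have "K0 \<subseteq> \<Union>(B ` K0)"
    using chain compactin_subset_topspace[OF K0(1)] by (auto simp: B_def)
  ultimately obtain \<B> where "finite \<B>" "\<B> \<subseteq> B ` K0" "K0 \<subseteq> \<Union>\<B>"
    using compactinD[OF K0(1), of "B ` K0"] by blast
  then obtain F where F: "finite F" "F \<subseteq> K0" "K0 \<subseteq> \<Union>(B ` F)"
    by (metis finite_subset_image)
  define G where "G = {g \<in> continuous_maps X Y. \<forall>x\<in>F. \<forall>y\<in>K. f y \<in> W x \<longrightarrow> g y \<in> P x}"
  \<comment> \<open>\<open>topspace Y\<close> keeps the intersection closed at points \<open>y\<close> for which it is taken over no \<open>x\<close>.\<close>
  define H where "H = {g \<in> continuous_maps X Y.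
    \<forall>y \<in> K \<inter> \<Union>\<C>. g y \<in> topspace Y \<inter> \<Inter>(V ` {x \<in> F. f y \<in> Q x})}"
  have mem: "g y \<in> topspace Y" if "g \<in> continuous_maps X Y" "y \<in> K" for g y
    using funcset_mem[OF continuous_map_funspace[OF mem_continuous_mapsD(1)[OF that(1)]]]
      subsetD[OF compactin_subset_topspace[OF K(2)] that(2)] by blast
  have "openin (compact_family_topology X \<K> Y) G"
    unfolding G_def using F chain
    by (intro openin_compact_family_finite_conditions[OF K fc]) auto
  moreover have "closedin (uniform_topology_on_subfamily X \<C> Y m) H"
    unfolding H_def
  proof (rule closedin_uniform_topology_on_subfamily)
    have "closedin (mtopology_of m) (\<Inter>(insert (topspace Y) (V ` {x \<in> F. f y \<in> Q x})))" for y
      using F chain top by (intro closedin_Inter) (auto simp flip: top topspace_mtopology_of)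
    then show "closedin (mtopology_of m) (topspace Y \<inter> \<Inter>(V ` {x \<in> F. f y \<in> Q x}))" for y
      by simp
  qed auto
  moreover have "f \<in> G"
    using f chain subsetD[OF F(2)] unfolding G_def by blast
  moreover have "G \<subseteq> H"
  proof
    fix g assume "g \<in> G"
    then have g: "g \<in> continuous_maps X Y" by (simp add: G_def)
    have "g y \<in> V x" if "y \<in> K" "x \<in> F" "f y \<in> Q x" for x y
    proof -
      have "x \<in> K0" using \<open>x \<in> F\<close> F(2) by blast
      then have "f y \<in> W x" using chain \<open>f y \<in> Q x\<close> by blast
      then have "g y \<in> P x" using \<open>g \<in> G\<close> that by (simp add: G_def)
      then show ?thesis using chain[OF \<open>x \<in> K0\<close>] by blast
    qed
    with g mem[OF g] show "g \<in> H" by (simp add: H_def)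
  qed
  moreover have "H \<subseteq> {g \<in> continuous_maps X Y. g ` K0 \<subseteq> U}"
  proof (clarify, intro conjI image_subsetI)
    fix g assume "g \<in> H"
    then show g: "g \<in> continuous_maps X Y" by (simp add: H_def)
    fix y assume "y \<in> K0"
    then obtain x where x: "x \<in> F" "f y \<in> Q x" using F by (auto simp: B_def)
    then have "x \<in> K0" using F by blast
    have "g y \<in> V x"
    proof (rule closed_condition_on_dense_part[OF dense _ fc mem_continuous_mapsD(1)[OF g]])
      show "openin Y (Q x)" "closedin Y (V x)" using chain[OF \<open>x \<in> K0\<close>] closed by auto
      show "K \<subseteq> topspace X" using compactin_subset_topspace[OF K(2)] .
      show "y \<in> K" "f y \<in> Q x" using \<open>y \<in> K0\<close> K0 x by auto
      show "g z \<in> V x" if "z \<in> K \<inter> \<Union>\<C>" "f z \<in> Q x" for z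
        using \<open>g \<in> H\<close> that x(1) by (auto simp: H_def)
    qed
    then show "g y \<in> U" using chain[OF \<open>x \<in> K0\<close>] by blast
  qed
  ultimately show ?thesis by blast
qed

end

theorem theorem1p3:
  fixes X :: "'a topology" and \<K> :: "'a set set" and Y :: "'b topology"
  assumes "separable_compact_family X \<K>"
    and "cometrizable_space Y"
  shows "cometrizable_space (compact_family_topology X \<K> Y)"
proof -
  obtain M where M: "topspace M = topspace Y" "\<And>U. openin M U \<Longrightarrow> openin Y U"
    "metrizable_space M" "neighbourhood_base_of (closedin M) Y"
    using assms(2) by (auto simp: cometrizable_space_def)
  then obtain A d where "Metric_space A d" and Ad: "M = Metric_space.mtopology A d"
    unfolding metrizable_space_def by blast
  define m where "m = metric (A, d)"
  have m: "mtopology_of m = M"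
    unfolding m_def using Metric_space.mtopology_of[OF \<open>Metric_space A d\<close>] Ad by simp
  have top: "mspace m = topspace Y"
    using M(1) m topspace_mtopology_of by metis
  have coarser: "openin Y U" if "openin (mtopology_of m) U" for U
    using that M(2) m by simp
  have compact: "\<And>K. K \<in> \<K> \<Longrightarrow> compactin X K"
    and hereditary: "\<And>K L. K \<in> \<K> \<Longrightarrow> compactin X L \<Longrightarrow> L \<subseteq> K \<Longrightarrow> L \<in> \<K>"
    and dense: "X closure_of (\<Union>\<K>) = topspace X"
    using assms(1) unfolding separable_compact_family_def by blast+
  obtain \<C> where \<C>: "\<C> \<subseteq> \<K>" "countable \<C>"
    "\<forall>K\<in>\<K>. \<exists>K'\<in>\<K>. K \<subseteq> K' \<and> subtopology X K' closure_of (K' \<inter> \<Union>\<C>) = K'"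
    using assms(1) unfolding separable_compact_family_def by blast
  have compact\<C>: "\<And>K. K \<in> \<C> \<Longrightarrow> compactin X K"
    using compact \<C>(1) by blast
  note ctx = compact\<C> top coarser
  let ?T = "compact_family_topology X \<K> Y" and ?N = "uniform_topology_on_subfamily X \<C> Y m"
  have topN: "topspace ?N = continuous_maps X Y"
    by (rule topspace_uniform_topology_on_subfamily[OF ctx])
  have "openin ?T U" if "openin ?N U" for U
    by (rule uniform_topology_on_subfamily_coarser[OF ctx \<C>(1) hereditary that])
  moreover have "metrizable_space ?N"
  proof (rule metrizable_uniform_topology_on_subfamily[OF ctx \<C>(2)])
    fix f g :: "'a \<Rightarrow> 'b"
    assume fg: "f \<in> continuous_maps X Y" "g \<in> continuous_maps X Y"
      and eq: "\<And>x. x \<in> \<Union>\<C> \<Longrightarrow> f x = g x"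
    have "f x = g x" if "x \<in> topspace X" for x
    proof (rule continuous_maps_eq_if_eq_on_dense_subfamily[OF dense _ \<C>(3) _ _ _ eq that])
      show "\<forall>K\<in>\<K>. K \<subseteq> topspace X" using compact compactin_subset_topspace by blast
      show "Hausdorff_space M" using M(3) by (rule metrizable_imp_Hausdorff_space)
      show "continuous_map X M f" "continuous_map X M g"
        using continuous_maps_into_metric[OF ctx] fg m by auto
    qed
    then show "f = g"
      by (rule extensionalityI[OF mem_continuous_mapsD(2)[OF fg(1)] mem_continuous_mapsD(2)[OF fg(2)]])
  qed
  moreover have "neighbourhood_base_of (closedin ?N) ?T"
    unfolding compact_family_topology_def
  proof (rule neighbourhood_base_of_topology_generated_by, rule closedin_Int)
    let ?S = "insert (continuous_maps X Y)
          {{f \<in> continuous_maps X Y. f ` K \<subseteq> U} | K U. K \<in> \<K> \<and> openin Y U}"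
    fix S f assume "S \<in> ?S" and f: "f \<in> S"
    then consider "S = continuous_maps X Y"
      | K U where "S = {f \<in> continuous_maps X Y. f ` K \<subseteq> U}" "K \<in> \<K>" "openin Y U"
      by blast
    then show "\<exists>G H. openin (topology_generated_by ?S) G \<and> closedin ?N H \<and> f \<in> G \<and> G \<subseteq> H \<and> H \<subseteq> S"
    proof cases
      case 1
      have "openin (topology_generated_by ?S) S"
        using \<open>S \<in> ?S\<close> by (rule topology_generated_by_Basis)
      moreover have "closedin ?N S"
        using 1 topN closedin_topspace by metis
      ultimately show ?thesis using f by blast
    next
      case 2
      obtain K' where K': "K' \<in> \<K>" "K \<subseteq> K'" "subtopology X K' closure_of (K' \<inter> \<Union>\<C>) = K'"
        using \<C>(3) 2(2) by blast
      show ?thesis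
        unfolding 2(1) compact_family_topology_def[symmetric]
        by (rule subbasic_neighbourhood_closed_in_uniform_topology[OF ctx _ K'(1) compact[OF K'(1)]
              hereditary[OF K'(1)] K'(3) compact[OF 2(2)] K'(2) _ 2(3)])
           (use M(4) m f 2 in auto)
    qed
  qed
  ultimately show ?thesis
    unfolding cometrizable_space_def using topN by (intro exI[of _ ?N]) simp
qed

end
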